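(* Let $\Omega\subset\mathbb{R}^d$ ($d=2,3$) be a bounded two-phase body with real scalar conductivities $\sigma^{(1)},\sigma^{(2)}$, where $\sigma^{(2)}\ne0$, with (known) nonzero volume fractions $f_1,f_2$ and thresholds $c^{(1)},c^{(2)}>0$. Let $(\mathbf{E}_m,\mathbf{J}_m)$, $m=1,2$, be the fields of two solutions of the conductivity equations in $\Omega$ (for two boundary conditions), and let $x^{(\alpha)},y^{(\alpha)},z^{(\alpha)},D^{(\alpha)}_{mn}$ and the feasible and compatible regions be as defined in the context. If the material has not broken down for either boundary condition, then: (a) the feasible region is nonempty and intersects the compatible region; (b) $x^{(2)}=(\langle\mathbf{E}_1\cdot\mathbf{J}_1\rangle-\sigma^{(1)}x^{(1)})/\sigma^{(2)}$, $y^{(2)}=(\langle\mathbf{E}_1\cdot\mathbf{J}_2\rangle-\sigma^{(1)}y^{(1)})/\sigma^{(2)}$, $z^{(2)}=(\langle\mathbf{E}_2\cdot\mathbf{J}_2\rangle-\sigma^{(1)}z^{(1)})/\sigma^{(2)}$; (c) for $\alpha=1,2$: $x^{(\alpha)}-D_{11}^{(\alpha)}/f_\alpha\ge0$ and $z^{(\alpha)}-D_{22}^{(\alpha)}/f_\alpha\ge0$, and hence $(c^{(\alpha)})^2f_\alpha^2\ge D_{11}^{(\alpha)}$ and $(c^{(\alpha)})^2f_\alpha^2\ge D_{22}^{(\alpha)}$; (d) for $\alpha=1,2$: $$\left(x^{(\alpha)}-\frac{D_{11}^{(\alpha)}}{f_\alpha}\right)\left(z^{(\alpha)}-\frac{D_{22}^{(\alpha)}}{f_\alpha}\right)\ge\left(y^{(\alpha)}-\frac{D_{12}^{(\alpha)}}{f_\alpha}\right)^2$$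 and $$\left((c^{(\alpha)})^2f_\alpha-\frac{D_{11}^{(\alpha)}}{f_\alpha}\right)\left((c^{(\alpha)})^2f_\alpha-\frac{D_{22}^{(\alpha)}}{f_\alpha}\right)\ge\left(y^{(\alpha)}-\frac{D_{12}^{(\alpha)}}{f_\alpha}\right)^2.$$
   Context: Phase $\alpha$ occupies $\Omega_\alpha\subset\Omega$ with characteristic function $\chi_\alpha$ ($\chi_1+\chi_2=1$ in $\Omega$ up to measure zero), and $f_\alpha=|\Omega_\alpha|/|\Omega|$. $\langle\cdot\rangle$ denotes the average over $\Omega$. The fields are real, square integrable, and satisfy (weakly) $\nabla\cdot\mathbf{J}_m=0$, $\mathbf{E}_m=-\nabla V_m$, $\mathbf{J}_m=\sigma\mathbf{E}_m$, with $\sigma=\sigma^{(1)}\chi_1+\sigma^{(2)}\chi_2$. Put $\mathbf{E}_m^{(\alpha)}=\chi_\alpha\mathbf{E}_m$. The material has not broken down for either boundary condition means $|\mathbf{E}^{(\alpha)}_m(\mathbf{x})|\le c^{(\alpha)}$ for (almost) all $\mathbf{x}\in\Omega$ and $m,\alpha\in\{1,2\}$. Define $A^{(\alpha)}_{mn}=\langle\mathbf{E}_m^{(\alpha)}\cdot\mathbf{E}_n^{(\alpha)}\rangle$, $D^{(\alpha)}_{mn}=\langle\mathbf{E}_m^{(\alpha)}\rangle\cdot\langle\mathbf{E}_n^{(\alpha)}\rangle$, $x^{(\alpha)}=A_{11}^{(\alpha)}$, $y^{(\alpha)}=A_{21}^{(\alpha)}$, $z^{(\alpha)}=A_{22}^{(\alpha)}$.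 Regions in $\mathbb{R}^3$: for an arbitrary triple $(X_1,Y_1,Z_1)\in\mathbb{R}^3$ put $X_2=(\langle\mathbf{E}_1\cdot\mathbf{J}_1\rangle-\sigma^{(1)}X_1)/\sigma^{(2)}$, $Y_2=(\langle\mathbf{E}_1\cdot\mathbf{J}_2\rangle-\sigma^{(1)}Y_1)/\sigma^{(2)}$, $Z_2=(\langle\mathbf{E}_2\cdot\mathbf{J}_2\rangle-\sigma^{(1)}Z_1)/\sigma^{(2)}$. The compatible region is the set of triples $(X_1,Y_1,Z_1)$ with $X_\alpha,Y_\alpha,Z_\alpha\le(c^{(\alpha)})^2f_\alpha$ for $\alpha=1,2$. The feasible region is the set of triples for which, for both $\alpha=1,2$, the matrix $$\mathbf{S}^{(\alpha)}=\begin{bmatrix}X_\alpha-D_{11}^{(\alpha)}/f_\alpha & Y_\alpha-D_{12}^{(\alpha)}/f_\alpha\\ Y_\alpha-D_{21}^{(\alpha)}/f_\alpha & Z_\alpha-D_{22}^{(\alpha)}/f_\alpha\end{bmatrix}$$ is positive semidefinite. *)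

theory Defs
  imports "HOL-Analysis.Analysis"
begin

section \<open>Test functions and weak derivatives\<close>

primrec k_times_differentiable :: "nat \<Rightarrow> (real^'n \<Rightarrow> real) \<Rightarrow> bool" where
  "k_times_differentiable 0 \<phi> \<longleftrightarrow> continuous_on UNIV \<phi>"
| "k_times_differentiable (Suc k) \<phi> \<longleftrightarrow>
     (\<forall>x. \<phi> differentiable (at x)) \<and>
     (\<forall>i. k_times_differentiable k (\<lambda>x. frechet_derivative \<phi> (at x) (axis i 1)))"

definition test_function :: "(real^'n) set \<Rightarrow> (real^'n \<Rightarrow> real) \<Rightarrow> bool" where
  "test_function \<Omega> \<phi> \<longleftrightarrow>
     (\<forall>k. k_times_differentiable k \<phi>) \<and>
     compact (closure {x. \<phi> x \<noteq> 0}) \<and> closure {x. \<phi> x \<noteq> 0} \<subseteq> \<Omega>"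

definition grad :: "(real^'n \<Rightarrow> real) \<Rightarrow> real^'n \<Rightarrow> real^'n" where
  "grad \<phi> x = (\<chi> i. frechet_derivative \<phi> (at x) (axis i 1))"

definition locally_integrable ::
  "(real^'n) set \<Rightarrow> (real^'n \<Rightarrow> 'b::{banach, second_countable_topology}) \<Rightarrow> bool" where
  "locally_integrable \<Omega> g \<longleftrightarrow>
     (\<forall>K. compact K \<and> K \<subseteq> \<Omega> \<longrightarrow> integrable (lebesgue_on K) g)"

definition square_integrable :: "(real^'n) set \<Rightarrow> (real^'n \<Rightarrow> real^'n) \<Rightarrow> bool" where
  "square_integrable \<Omega> F \<longleftrightarrow>
     F \<in> borel_measurable (lebesgue_on \<Omega>) \<and>
     integrable (lebesgue_on \<Omega>) (\<lambda>x. (norm (F x))\<^sup>2)"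

definition has_weak_gradient ::
  "(real^'n) set \<Rightarrow> (real^'n \<Rightarrow> real) \<Rightarrow> (real^'n \<Rightarrow> real^'n) \<Rightarrow> bool" where
  "has_weak_gradient \<Omega> V G \<longleftrightarrow>
     locally_integrable \<Omega> V \<and> locally_integrable \<Omega> G \<and>
     (\<forall>\<phi>. test_function \<Omega> \<phi> \<longrightarrow>
        (LINT x|lebesgue_on \<Omega>. V x *\<^sub>R grad \<phi> x) = - (LINT x|lebesgue_on \<Omega>. \<phi> x *\<^sub>R G x))"

definition weakly_divergence_free ::
  "(real^'n) set \<Rightarrow> (real^'n \<Rightarrow> real^'n) \<Rightarrow> bool" where
  "weakly_divergence_free \<Omega> J \<longleftrightarrow>
     locally_integrable \<Omega> J \<and>
     (\<forall>\<phi>. test_function \<Omega> \<phi> \<longrightarrow> (LINT x|lebesgue_on \<Omega>. J x \<bullet> grad \<phi> x) = 0)"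


section \<open>Two-phase conducting bodies\<close>

text \<open>Phases and boundary conditions are indexed by the two-element type \<open>2\<close>, whose
  elements are \<open>1\<close> and \<open>2\<close>. The set \<open>P \<alpha>\<close> is the region occupied by phase \<open>\<alpha>\<close>.\<close>

definition two_phase_body :: "(real^'n) set \<Rightarrow> (2 \<Rightarrow> (real^'n) set) \<Rightarrow> bool" where
  "two_phase_body \<Omega> P \<longleftrightarrow>
     open \<Omega> \<and> bounded \<Omega> \<and>
     (\<forall>\<alpha>. P \<alpha> \<in> sets lebesgue \<and> P \<alpha> \<subseteq> \<Omega>) \<and>
     (AE x in lebesgue_on \<Omega>. indicat_real (P 1) x + indicat_real (P 2) x = 1)"

definition conductivity ::
  "(2 \<Rightarrow> (real^'n) set) \<Rightarrow> (2 \<Rightarrow> real) \<Rightarrow> real^'n \<Rightarrow> real" where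
  "conductivity P \<sigma> x = \<sigma> 1 * indicat_real (P 1) x + \<sigma> 2 * indicat_real (P 2) x"

text \<open>The potential \<open>V\<close> need only be locally integrable, and no boundary condition is imposed:
  every weak solution in the interior is allowed.\<close>

definition conductivity_solution ::
  "(real^'n) set \<Rightarrow> (2 \<Rightarrow> (real^'n) set) \<Rightarrow> (2 \<Rightarrow> real) \<Rightarrow>
   (real^'n \<Rightarrow> real) \<Rightarrow> (real^'n \<Rightarrow> real^'n) \<Rightarrow> (real^'n \<Rightarrow> real^'n) \<Rightarrow> bool" where
  "conductivity_solution \<Omega> P \<sigma> V E J \<longleftrightarrow>
     square_integrable \<Omega> E \<and> square_integrable \<Omega> J \<and>
     weakly_divergence_free \<Omega> J \<and>
     has_weak_gradient \<Omega> V (\<lambda>x. - E x) \<and>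
     (AE x in lebesgue_on \<Omega>. J x = conductivity P \<sigma> x *\<^sub>R E x)"

definition volume_fraction :: "(real^'n) set \<Rightarrow> (2 \<Rightarrow> (real^'n) set) \<Rightarrow> 2 \<Rightarrow> real" where
  "volume_fraction \<Omega> P \<alpha> = measure lebesgue (P \<alpha>) / measure lebesgue \<Omega>"

definition average ::
  "(real^'n) set \<Rightarrow> (real^'n \<Rightarrow> 'b::{banach, second_countable_topology}) \<Rightarrow> 'b" where
  "average \<Omega> g = (1 / measure lebesgue \<Omega>) *\<^sub>R (LINT x|lebesgue_on \<Omega>. g x)"

definition phase_field ::
  "(2 \<Rightarrow> (real^'n) set) \<Rightarrow> (2 \<Rightarrow> real^'n \<Rightarrow> real^'n) \<Rightarrow> 2 \<Rightarrow> 2 \<Rightarrow> real^'n \<Rightarrow> real^'n" where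
  "phase_field P E \<alpha> m x = indicat_real (P \<alpha>) x *\<^sub>R E m x"

definition not_broken_down ::
  "(real^'n) set \<Rightarrow> (2 \<Rightarrow> (real^'n) set) \<Rightarrow> (2 \<Rightarrow> real) \<Rightarrow> (2 \<Rightarrow> real^'n \<Rightarrow> real^'n) \<Rightarrow> bool" where
  "not_broken_down \<Omega> P c E \<longleftrightarrow>
     (\<forall>m \<alpha>. AE x in lebesgue_on \<Omega>. norm (phase_field P E \<alpha> m x) \<le> c \<alpha>)"

definition A_mat ::
  "(real^'n) set \<Rightarrow> (2 \<Rightarrow> (real^'n) set) \<Rightarrow> (2 \<Rightarrow> real^'n \<Rightarrow> real^'n) \<Rightarrow> 2 \<Rightarrow> 2 \<Rightarrow> 2 \<Rightarrow> real" where
  "A_mat \<Omega> P E \<alpha> m n = average \<Omega> (\<lambda>x. phase_field P E \<alpha> m x \<bullet> phase_field P E \<alpha> n x)"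

definition D_mat ::
  "(real^'n) set \<Rightarrow> (2 \<Rightarrow> (real^'n) set) \<Rightarrow> (2 \<Rightarrow> real^'n \<Rightarrow> real^'n) \<Rightarrow> 2 \<Rightarrow> 2 \<Rightarrow> 2 \<Rightarrow> real" where
  "D_mat \<Omega> P E \<alpha> m n = average \<Omega> (phase_field P E \<alpha> m) \<bullet> average \<Omega> (phase_field P E \<alpha> n)"

definition energy ::
  "(real^'n) set \<Rightarrow> (2 \<Rightarrow> real^'n \<Rightarrow> real^'n) \<Rightarrow> (2 \<Rightarrow> real^'n \<Rightarrow> real^'n) \<Rightarrow> 2 \<Rightarrow> 2 \<Rightarrow> real" where
  "energy \<Omega> E J m n = average \<Omega> (\<lambda>x. E m x \<bullet> J n x)"


section \<open>Feasible and compatible regions\<close>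

text \<open>\<open>phase_coord \<sigma> w T \<alpha>\<close> is \<open>T\<^sub>\<alpha>\<close>, where \<open>T\<^sub>1 = T\<close> and \<open>T\<^sub>2\<close> solves
  \<open>\<sigma>\<^sub>1 T\<^sub>1 + \<sigma>\<^sub>2 T\<^sub>2 = w\<close>.\<close>

definition phase_coord :: "(2 \<Rightarrow> real) \<Rightarrow> real \<Rightarrow> real \<Rightarrow> 2 \<Rightarrow> real" where
  "phase_coord \<sigma> w T \<alpha> = (if \<alpha> = 1 then T else (w - \<sigma> 1 * T) / \<sigma> 2)"

definition positive_semidefinite :: "real^'k^'k \<Rightarrow> bool" where
  "positive_semidefinite S \<longleftrightarrow> transpose S = S \<and> (\<forall>v. 0 \<le> v \<bullet> (S *v v))"

definition compatible_region ::
  "(real^'n) set \<Rightarrow> (2 \<Rightarrow> (real^'n) set) \<Rightarrow> (2 \<Rightarrow> real) \<Rightarrow> (2 \<Rightarrow> real) \<Rightarrow>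
   (2 \<Rightarrow> real^'n \<Rightarrow> real^'n) \<Rightarrow> (2 \<Rightarrow> real^'n \<Rightarrow> real^'n) \<Rightarrow> (real \<times> real \<times> real) set" where
  "compatible_region \<Omega> P \<sigma> c E J =
     {(X, Y, Z). \<forall>\<alpha>.
        phase_coord \<sigma> (energy \<Omega> E J 1 1) X \<alpha> \<le> (c \<alpha>)\<^sup>2 * volume_fraction \<Omega> P \<alpha> \<and>
        phase_coord \<sigma> (energy \<Omega> E J 1 2) Y \<alpha> \<le> (c \<alpha>)\<^sup>2 * volume_fraction \<Omega> P \<alpha> \<and>
        phase_coord \<sigma> (energy \<Omega> E J 2 2) Z \<alpha> \<le> (c \<alpha>)\<^sup>2 * volume_fraction \<Omega> P \<alpha>}"

definition S_mat ::
  "(real^'n) set \<Rightarrow> (2 \<Rightarrow> (real^'n) set) \<Rightarrow> (2 \<Rightarrow> real^'n \<Rightarrow> real^'n) \<Rightarrow> 2 \<Rightarrow>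
   real \<Rightarrow> real \<Rightarrow> real \<Rightarrow> real^2^2" where
  "S_mat \<Omega> P E \<alpha> X Y Z =
     (let D = D_mat \<Omega> P E \<alpha>; f = volume_fraction \<Omega> P \<alpha> in
      vector [vector [X - D 1 1 / f, Y - D 1 2 / f],
              vector [Y - D 2 1 / f, Z - D 2 2 / f]])"

definition feasible_region ::
  "(real^'n) set \<Rightarrow> (2 \<Rightarrow> (real^'n) set) \<Rightarrow> (2 \<Rightarrow> real) \<Rightarrow>
   (2 \<Rightarrow> real^'n \<Rightarrow> real^'n) \<Rightarrow> (2 \<Rightarrow> real^'n \<Rightarrow> real^'n) \<Rightarrow> (real \<times> real \<times> real) set" where
  "feasible_region \<Omega> P \<sigma> E J =
     {(X, Y, Z). \<forall>\<alpha>. positive_semidefinite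
        (S_mat \<Omega> P E \<alpha>
          (phase_coord \<sigma> (energy \<Omega> E J 1 1) X \<alpha>)
          (phase_coord \<sigma> (energy \<Omega> E J 1 2) Y \<alpha>)
          (phase_coord \<sigma> (energy \<Omega> E J 2 2) Z \<alpha>))}"

end

theory Submission
  imports Defs
begin

text \<open>For a set \<open>S\<close> of measure \<open>m\<close> and a field \<open>G\<close> vanishing off \<open>S\<close>, integrating
  \<open>0 \<le> norm (m G - 1\<^sub>S \<integral>G)\<^sup>2\<close> bounds \<open>norm (\<integral>G)\<^sup>2\<close> by \<open>m \<integral>(norm G)\<^sup>2\<close>. Applied to all
  combinations \<open>a E\<^sub>1 + b E\<^sub>2\<close> in one phase, this says that the matrix \<open>A - D / f\<close> of that phase
  is positive semidefinite, and the pointwise bound on the field gives \<open>A\<^sub>m\<^sub>m \<le> c\<^sup>2 f\<close>. The point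
  \<open>(x\<^sub>1, y\<^sub>1, z\<^sub>1)\<close> of the actual fields therefore lies in both regions, since the energies
  split as \<open>\<sigma>\<^sub>1 A\<^sub>1 + \<sigma>\<^sub>2 A\<^sub>2\<close> over the phases.\<close>

section \<open>Square integrable fields\<close>

text \<open>Domination: Cauchy-Schwarz followed by \<open>2 s t \<le> s^2 + t^2\<close> bounds the
  inner product by the sum of the two integrable squares.\<close>

lemma integrable_inner_of_square_integrable:
  fixes F G :: "'a \<Rightarrow> 'b::euclidean_space"
  assumes [measurable]: "F \<in> borel_measurable M" "G \<in> borel_measurable M"
    and F: "integrable M (\<lambda>x. (norm (F x))\<^sup>2)" and G: "integrable M (\<lambda>x. (norm (G x))\<^sup>2)"
  shows "integrable M (\<lambda>x. F x \<bullet> G x)"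
proof (rule Bochner_Integration.integrable_bound)
  show "integrable M (\<lambda>x. (norm (F x))\<^sup>2 + (norm (G x))\<^sup>2)"
    using F G by simp
  have "\<bar>F x \<bullet> G x\<bar> \<le> (norm (F x))\<^sup>2 + (norm (G x))\<^sup>2" for x
  proof -
    have "\<bar>F x \<bullet> G x\<bar> \<le> norm (F x) * norm (G x)"
      by (rule Cauchy_Schwarz_ineq2)
    also have "\<dots> \<le> (norm (F x))\<^sup>2 + (norm (G x))\<^sup>2"
      using sum_squares_bound[of "norm (F x)" "norm (G x)"]
        mult_nonneg_nonneg[OF norm_ge_zero[of "F x"] norm_ge_zero[of "G x"]] by linarith
    finally show ?thesis .
  qed
  then show "AE x in M. norm (F x \<bullet> G x) \<le> norm ((norm (F x))\<^sup>2 + (norm (G x))\<^sup>2)"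
    by (auto intro!: AE_I2 order_trans[OF _ abs_ge_self])
qed simp

text \<open>Since \<open>2 t \<le> 1 + t^2\<close>, the norm is dominated by
  \<open>1 + (norm (F x))^2\<close>; the constant 1 is integrable because the measure is
  finite.\<close>

lemma (in finite_measure) integrable_of_square_integrable:
  fixes F :: "'a \<Rightarrow> 'b::euclidean_space"
  assumes [measurable]: "F \<in> borel_measurable M"
    and F: "integrable M (\<lambda>x. (norm (F x))\<^sup>2)"
  shows "integrable M F"
proof (rule Bochner_Integration.integrable_bound)
  show "integrable M (\<lambda>x. 1 + (norm (F x))\<^sup>2)"
    using F by simp
  have "norm (F x) \<le> 1 + (norm (F x))\<^sup>2" for x
    using sum_squares_bound[of 1 "norm (F x)"] norm_ge_zero[of "F x"]
    unfolding power_one mult_1_right by linarith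
  then show "AE x in M. norm (F x) \<le> norm (1 + (norm (F x))\<^sup>2)"
    by (auto intro!: AE_I2 order_trans[OF _ abs_ge_self])
qed simp

text \<open>This is Cauchy-Schwarz against the indicator of \<open>S\<close>. The factor is the
  measure of \<open>S\<close> rather than of the whole space, which later produces the division by
  \<open>f \<alpha>\<close>.\<close>

lemma (in finite_measure) norm_integral_square_le:
  fixes G :: "'a \<Rightarrow> 'b::euclidean_space"
  assumes S: "S \<in> sets M" and off: "\<And>x. x \<notin> S \<Longrightarrow> G x = 0" and pos: "0 < measure M S"
    and meas: "G \<in> borel_measurable M" and sq: "integrable M (\<lambda>x. (norm (G x))\<^sup>2)"
  shows "(norm (LINT x|M. G x))\<^sup>2 \<le> measure M S * (LINT x|M. (norm (G x))\<^sup>2)"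
proof -
  define m where "m = measure M S"
  define I where "I = (LINT x|M. G x)"
  have G: "integrable M G"
    using meas sq by (rule integrable_of_square_integrable)
  have ind: "integrable M (\<lambda>x. indicat_real S x)"
    using S by (simp add: less_top[symmetric])
  \<comment> \<open>The vector is \<open>m\<close> times the deviation of \<open>G\<close> from its
    mean over \<open>S\<close>; this scaling avoids a division. The cross term carries no indicator
    because \<open>G\<close> vanishes off \<open>S\<close>.\<close>
  have eq: "(norm (m *\<^sub>R G x - indicat_real S x *\<^sub>R I))\<^sup>2 =
      m\<^sup>2 * (norm (G x))\<^sup>2 - 2 * m * (G x \<bullet> I) + (norm I)\<^sup>2 * indicat_real S x" for x
    using off[of x] unfolding power2_norm_eq_inner
    by (cases "x \<in> S")
       (simp_all add: inner_diff_left inner_diff_right inner_commute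
         algebra_simps power2_eq_square)
  have "0 \<le> (LINT x|M. (norm (m *\<^sub>R G x - indicat_real S x *\<^sub>R I))\<^sup>2)"
    by (rule integral_nonneg_AE) simp
  also have "\<dots> = m\<^sup>2 * (LINT x|M. (norm (G x))\<^sup>2) - 2 * m * (I \<bullet> I) + (norm I)\<^sup>2 * m"
    unfolding eq using sq G ind S sets.sets_into_space[OF S]
    by (simp add: I_def m_def Int_absorb2)
  \<comment> \<open>The last two terms merge, as \<open>- 2 m |I|^2 + m |I|^2 = - m |I|^2\<close>,
    and the common factor \<open>m > 0\<close> can be cancelled.\<close>
  finally have "0 \<le> m * (m * (LINT x|M. (norm (G x))\<^sup>2) - (norm I)\<^sup>2)"
    unfolding power2_norm_eq_inner by (simp add: algebra_simps power2_eq_square)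
  with pos show ?thesis
    by (simp add: m_def I_def zero_le_mult_iff)
qed


section \<open>Binary quadratic forms\<close>

lemma binary_form_nonneg_imp:
  fixes p q r :: real
  assumes form: "\<And>a b. 0 \<le> p * a\<^sup>2 + 2 * q * a * b + r * b\<^sup>2"
  shows "0 \<le> p" "0 \<le> r" "q\<^sup>2 \<le> p * r"
proof -
  show p: "0 \<le> p" and r: "0 \<le> r"
    using form[of 1 0] form[of 0 1] by simp_all
  show "q\<^sup>2 \<le> p * r"
  proof (rule ccontr)
    assume less: "\<not> q\<^sup>2 \<le> p * r"
    \<comment> \<open>The vectors \<open>(q, -p)\<close> and \<open>(r, -q)\<close> are orthogonal
      to the first and second row of the matrix, so the form takes the value of a diagonal entry
      times the determinant. A negative determinant forces both diagonal entries to vanish, and then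
      \<open>(1, -q)\<close> gives \<open>- 2 q^2 < 0\<close>.\<close>
    have "0 \<le> p * (p * r - q\<^sup>2)" "0 \<le> r * (p * r - q\<^sup>2)"
      using form[of q "- p"] form[of r "- q"]
      by (simp_all add: algebra_simps power2_eq_square)
    with less p r have "p = 0" "r = 0"
      by (auto simp: zero_le_mult_iff mult_le_0_iff)
    with form[of 1 "- q"] less show False
      by (simp add: power2_eq_square)
  qed
qed

lemma positive_semidefinite_2I:
  fixes p q r :: real
  assumes "\<And>a b. 0 \<le> p * a\<^sup>2 + 2 * q * a * b + r * b\<^sup>2"
  shows "positive_semidefinite (vector [vector [p, q], vector [q, r]] :: real^2^2)"
  unfolding positive_semidefinite_def
proof (intro conjI allI)
  show "transpose (vector [vector [p, q], vector [q, r]] :: real^2^2)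
      = vector [vector [p, q], vector [q, r]]"
    by (simp add: transpose_def vec_eq_iff forall_2)
  fix v :: "real^2"
  show "0 \<le> v \<bullet> ((vector [vector [p, q], vector [q, r]] :: real^2^2) *v v)"
    using assms[of "v $ 1" "v $ 2"]
    by (simp add: inner_vec_def matrix_vector_mult_def sum_2 algebra_simps power2_eq_square)
qed


section \<open>Phase averages\<close>

locale two_phase_fields =
  fixes \<Omega> :: "(real^'n) set" and P :: "2 \<Rightarrow> (real^'n) set"
    and E :: "2 \<Rightarrow> real^'n \<Rightarrow> real^'n"
  assumes body: "two_phase_body \<Omega> P"
    and fraction_nonzero: "volume_fraction \<Omega> P \<alpha> \<noteq> 0"
    and field: "square_integrable \<Omega> (E m)"
begin

lemma domain_lmeasurable: "\<Omega> \<in> lmeasurable"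
  using body by (simp add: two_phase_body_def lmeasurable_open)

sublocale finite_measure "lebesgue_on \<Omega>"
  using domain_lmeasurable by (rule finite_measure_lebesgue_on)

lemma phase_sets: "P \<alpha> \<in> sets (lebesgue_on \<Omega>)"
  using body domain_lmeasurable
  by (auto simp: two_phase_body_def sets_restrict_space_iff fmeasurableD)

lemma measure_phase: "measure (lebesgue_on \<Omega>) (P \<alpha>) = measure lebesgue (P \<alpha>)"
  using body domain_lmeasurable
  by (auto simp: two_phase_body_def intro!: measure_restrict_space fmeasurableD)

text \<open>Division by zero yields 0, so a domain of measure zero would have volume fraction
  0.\<close>

lemma measure_domain_pos: "0 < measure lebesgue \<Omega>"
  using fraction_nonzero[of 1] by (auto simp: volume_fraction_def zero_less_measure_iff)

lemma measure_phase_pos: "0 < measure lebesgue (P \<alpha>)"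
  using fraction_nonzero[of \<alpha>] by (auto simp: volume_fraction_def zero_less_measure_iff)

lemma fraction_pos: "0 < volume_fraction \<Omega> P \<alpha>"
  using measure_domain_pos measure_phase_pos by (simp add: volume_fraction_def)

lemma field_measurable: "E m \<in> borel_measurable (lebesgue_on \<Omega>)"
  using field by (simp add: square_integrable_def)

lemma phase_field_measurable: "phase_field P E \<alpha> m \<in> borel_measurable (lebesgue_on \<Omega>)"
  unfolding phase_field_def[abs_def]
  using field_measurable phase_sets[of \<alpha>] by (intro borel_measurable_scaleR) auto

lemma phase_field_square_integrable:
  "integrable (lebesgue_on \<Omega>) (\<lambda>x. (norm (phase_field P E \<alpha> m x))\<^sup>2)"
proof (rule Bochner_Integration.integrable_bound)
  show "integrable (lebesgue_on \<Omega>) (\<lambda>x. (norm (E m x))\<^sup>2)"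
    using field by (simp add: square_integrable_def)
  show "(\<lambda>x. (norm (phase_field P E \<alpha> m x))\<^sup>2) \<in> borel_measurable (lebesgue_on \<Omega>)"
    using phase_field_measurable by simp
qed (auto simp: phase_field_def indicator_def)

lemma phase_field_integrable: "integrable (lebesgue_on \<Omega>) (phase_field P E \<alpha> m)"
  by (rule integrable_of_square_integrable[OF phase_field_measurable phase_field_square_integrable])

lemma phase_field_inner_integrable:
  "integrable (lebesgue_on \<Omega>) (\<lambda>x. phase_field P E \<alpha> m x \<bullet> phase_field P E \<alpha> n x)"
  by (intro integrable_inner_of_square_integrable phase_field_measurable
      phase_field_square_integrable)

lemma A_mat_commute: "A_mat \<Omega> P E \<alpha> m n = A_mat \<Omega> P E \<alpha> n m"
  by (simp add: A_mat_def inner_commute)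

lemma D_mat_commute: "D_mat \<Omega> P E \<alpha> m n = D_mat \<Omega> P E \<alpha> n m"
  by (simp add: D_mat_def inner_commute)

lemma phase_form_nonneg:
  defines "Q \<equiv> \<lambda>\<alpha> m n. A_mat \<Omega> P E \<alpha> m n - D_mat \<Omega> P E \<alpha> m n / volume_fraction \<Omega> P \<alpha>"
  shows "0 \<le> Q \<alpha> m m * a\<^sup>2 + 2 * Q \<alpha> m n * a * b + Q \<alpha> n n * b\<^sup>2"
proof -
  let ?M = "lebesgue_on \<Omega>" and ?F = "phase_field P E \<alpha>"
  let ?G = "\<lambda>x. a *\<^sub>R ?F m x + b *\<^sub>R ?F n x"
  define \<mu> where "\<mu> = measure lebesgue \<Omega>"
  define \<pi> where "\<pi> = measure lebesgue (P \<alpha>)"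
  define u where "u = (LINT x|?M. ?F m x)"
  define v where "v = (LINT x|?M. ?F n x)"
  define A where "A k l = (LINT x|?M. ?F k x \<bullet> ?F l x)" for k l
  have \<mu>: "0 < \<mu>" and \<pi>: "0 < \<pi>"
    using measure_domain_pos measure_phase_pos by (simp_all add: \<mu>_def \<pi>_def)
  have sq: "(norm (?G x))\<^sup>2 =
      a\<^sup>2 * (?F m x \<bullet> ?F m x) + 2 * a * b * (?F m x \<bullet> ?F n x) + b\<^sup>2 * (?F n x \<bullet> ?F n x)" for x
    unfolding power2_norm_eq_inner
    by (simp add: inner_add_left inner_add_right inner_commute algebra_simps power2_eq_square)
  have G_sq: "integrable ?M (\<lambda>x. (norm (?G x))\<^sup>2)"
    unfolding sq by (intro Bochner_Integration.integrable_add integrable_mult_right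
        phase_field_inner_integrable)
  have G_meas: "?G \<in> borel_measurable ?M"
    using phase_field_measurable by simp
  have "(norm (LINT x|?M. ?G x))\<^sup>2 \<le> \<pi> * (LINT x|?M. (norm (?G x))\<^sup>2)"
    unfolding \<pi>_def measure_phase[symmetric]
    using phase_sets _ _ G_meas G_sq
    by (rule norm_integral_square_le)
      (simp_all add: phase_field_def measure_phase measure_phase_pos)
  moreover have "(LINT x|?M. ?G x) = a *\<^sub>R u + b *\<^sub>R v"
    unfolding u_def v_def using phase_field_integrable by simp
  moreover have "(LINT x|?M. (norm (?G x))\<^sup>2) = a\<^sup>2 * A m m + 2 * a * b * A m n + b\<^sup>2 * A n n"
    unfolding sq A_def using phase_field_inner_integrable by simp
  ultimately have key:
    "(norm (a *\<^sub>R u + b *\<^sub>R v))\<^sup>2 \<le> \<pi> * (a\<^sup>2 * A m m + 2 * a * b * A m n + b\<^sup>2 * A n n)"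
    by simp
  \<comment> \<open>Averaging puts \<open>1 / \<mu>\<close> on the \<open>A\<close> part and
    \<open>1 / \<mu>^2\<close> on the \<open>D\<close> part; dividing the latter by
    \<open>f = \<pi> / \<mu>\<close> leaves the common denominator \<open>\<mu> * \<pi>\<close>. The
    form is then the gap in \<open>key\<close> divided by it.\<close>
  have Q: "Q \<alpha> m m = (\<pi> * A m m - u \<bullet> u) / (\<mu> * \<pi>)"
    "Q \<alpha> m n = (\<pi> * A m n - u \<bullet> v) / (\<mu> * \<pi>)"
    "Q \<alpha> n n = (\<pi> * A n n - v \<bullet> v) / (\<mu> * \<pi>)"
    using \<mu> \<pi>
    unfolding Q_def A_mat_def D_mat_def volume_fraction_def average_def
      \<mu>_def[symmetric] \<pi>_def[symmetric] A_def[symmetric] u_def[symmetric] v_def[symmetric]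
    by (simp_all add: field_simps)
  have "Q \<alpha> m m * a\<^sup>2 + 2 * Q \<alpha> m n * a * b + Q \<alpha> n n * b\<^sup>2 =
      (\<pi> * (a\<^sup>2 * A m m + 2 * a * b * A m n + b\<^sup>2 * A n n) - (norm (a *\<^sub>R u + b *\<^sub>R v))\<^sup>2)
        / (\<mu> * \<pi>)"
    unfolding Q power2_norm_eq_inner
    by (simp add: inner_add_left inner_add_right inner_commute add_divide_distrib
        diff_divide_distrib algebra_simps power2_eq_square)
  with key \<mu> \<pi> show ?thesis
    by simp
qed

lemma A_mat_diag_le:
  assumes "not_broken_down \<Omega> P c E"
  shows "A_mat \<Omega> P E \<alpha> m m \<le> (c \<alpha>)\<^sup>2 * volume_fraction \<Omega> P \<alpha>"
proof -
  let ?M = "lebesgue_on \<Omega>" and ?F = "phase_field P E \<alpha> m"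
  have "AE x in ?M. norm (?F x) \<le> c \<alpha>"
    using assms by (simp add: not_broken_down_def)
  \<comment> \<open>Keeping the indicator, which is allowed because the field vanishes off the
    phase, gives the factor \<open>f\<close> after averaging.\<close>
  then have "AE x in ?M. ?F x \<bullet> ?F x \<le> (c \<alpha>)\<^sup>2 * indicat_real (P \<alpha>) x"
  proof eventually_elim
    case (elim x)
    then have "(norm (?F x))\<^sup>2 \<le> (c \<alpha>)\<^sup>2"
      by (intro power_mono) simp_all
    then show ?case
      by (cases "x \<in> P \<alpha>") (simp_all add: power2_norm_eq_inner phase_field_def)
  qed
  moreover have "integrable ?M (\<lambda>x. indicat_real (P \<alpha>) x)"
    using phase_sets by (simp add: less_top[symmetric])
  ultimately have "(LINT x|?M. ?F x \<bullet> ?F x) \<le> (LINT x|?M. (c \<alpha>)\<^sup>2 * indicat_real (P \<alpha>) x)"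
    using phase_field_inner_integrable by (intro integral_mono_AE) simp_all
  also have "\<dots> = (c \<alpha>)\<^sup>2 * measure lebesgue (P \<alpha>)"
    using sets.sets_into_space[OF phase_sets[of \<alpha>]]
    by (simp add: measure_phase Int_absorb2)
  finally show ?thesis
    using measure_domain_pos
    by (simp add: A_mat_def average_def volume_fraction_def divide_right_mono)
qed

text \<open>The indicators are idempotent, so inserting the constitutive law turns the integrand
  into a sum of one-phase inner products weighted by the conductivities. This is what ties the
  averages of phase 2 to those of phase 1.\<close>

lemma energy_split:
  assumes J: "AE x in lebesgue_on \<Omega>. J n x = conductivity P \<sigma> x *\<^sub>R E n x"
    and J_meas: "J n \<in> borel_measurable (lebesgue_on \<Omega>)"
  shows "energy \<Omega> E J m n = \<sigma> 1 * A_mat \<Omega> P E 1 m n + \<sigma> 2 * A_mat \<Omega> P E 2 m n"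
proof -
  let ?M = "lebesgue_on \<Omega>" and ?F = "phase_field P E"
  have "(LINT x|?M. E m x \<bullet> J n x) =
      (LINT x|?M. \<sigma> 1 * (?F 1 m x \<bullet> ?F 1 n x) + \<sigma> 2 * (?F 2 m x \<bullet> ?F 2 n x))"
  proof (rule integral_cong_AE)
    show "(\<lambda>x. E m x \<bullet> J n x) \<in> borel_measurable ?M"
      using field_measurable J_meas by simp
    show "(\<lambda>x. \<sigma> 1 * (?F 1 m x \<bullet> ?F 1 n x) + \<sigma> 2 * (?F 2 m x \<bullet> ?F 2 n x))
        \<in> borel_measurable ?M"
      using phase_field_measurable by simp
    show "AE x in ?M. E m x \<bullet> J n x =
        \<sigma> 1 * (?F 1 m x \<bullet> ?F 1 n x) + \<sigma> 2 * (?F 2 m x \<bullet> ?F 2 n x)"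
      using J
    proof eventually_elim
      case (elim x)
      then show ?case
        by (auto simp: conductivity_def phase_field_def indicator_def algebra_simps)
    qed
  qed
  also have "\<dots> = \<sigma> 1 * (LINT x|?M. ?F 1 m x \<bullet> ?F 1 n x)
      + \<sigma> 2 * (LINT x|?M. ?F 2 m x \<bullet> ?F 2 n x)"
    using phase_field_inner_integrable by simp
  finally show ?thesis
    by (simp add: energy_def A_mat_def average_def algebra_simps add_divide_distrib)
qed

end

theorem theorem3p1:
  fixes \<Omega> :: "(real^'n) set" and P :: "2 \<Rightarrow> (real^'n) set"
    and \<sigma> c :: "2 \<Rightarrow> real"
    and V :: "2 \<Rightarrow> real^'n \<Rightarrow> real"
    and E J :: "2 \<Rightarrow> real^'n \<Rightarrow> real^'n"
    and f x y z :: "2 \<Rightarrow> real" and D :: "2 \<Rightarrow> 2 \<Rightarrow> 2 \<Rightarrow> real"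
  assumes dim: "CARD('n) = 2 \<or> CARD('n) = 3"
    and body: "two_phase_body \<Omega> P"
    and sigma: "\<sigma> 2 \<noteq> 0"
    and f: "f = volume_fraction \<Omega> P"
    and f_nonzero: "\<And>\<alpha>. f \<alpha> \<noteq> 0"
    and c_pos: "\<And>\<alpha>. c \<alpha> > 0"
    and solution: "\<And>m. conductivity_solution \<Omega> P \<sigma> (V m) (E m) (J m)"
    and x: "\<And>\<alpha>. x \<alpha> = A_mat \<Omega> P E \<alpha> 1 1"
    and y: "\<And>\<alpha>. y \<alpha> = A_mat \<Omega> P E \<alpha> 2 1"
    and z: "\<And>\<alpha>. z \<alpha> = A_mat \<Omega> P E \<alpha> 2 2"
    and D: "\<And>\<alpha> m n. D \<alpha> m n = D_mat \<Omega> P E \<alpha> m n"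
    and intact: "not_broken_down \<Omega> P c E"
  shows
    "(feasible_region \<Omega> P \<sigma> E J \<noteq> {} \<and>
      feasible_region \<Omega> P \<sigma> E J \<inter> compatible_region \<Omega> P \<sigma> c E J \<noteq> {})
     \<and>
     (x 2 = (energy \<Omega> E J 1 1 - \<sigma> 1 * x 1) / \<sigma> 2 \<and>
      y 2 = (energy \<Omega> E J 1 2 - \<sigma> 1 * y 1) / \<sigma> 2 \<and>
      z 2 = (energy \<Omega> E J 2 2 - \<sigma> 1 * z 1) / \<sigma> 2)
     \<and>
     (\<forall>\<alpha>. x \<alpha> - D \<alpha> 1 1 / f \<alpha> \<ge> 0 \<and> z \<alpha> - D \<alpha> 2 2 / f \<alpha> \<ge> 0 \<and>
          (c \<alpha>)\<^sup>2 * (f \<alpha>)\<^sup>2 \<ge> D \<alpha> 1 1 \<and> (c \<alpha>)\<^sup>2 * (f \<alpha>)\<^sup>2 \<ge> D \<alpha> 2 2)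
     \<and>
     (\<forall>\<alpha>. (x \<alpha> - D \<alpha> 1 1 / f \<alpha>) * (z \<alpha> - D \<alpha> 2 2 / f \<alpha>) \<ge> (y \<alpha> - D \<alpha> 1 2 / f \<alpha>)\<^sup>2 \<and>
          ((c \<alpha>)\<^sup>2 * f \<alpha> - D \<alpha> 1 1 / f \<alpha>) * ((c \<alpha>)\<^sup>2 * f \<alpha> - D \<alpha> 2 2 / f \<alpha>)
            \<ge> (y \<alpha> - D \<alpha> 1 2 / f \<alpha>)\<^sup>2)"
proof -
  have sol: "square_integrable \<Omega> (E m)" "square_integrable \<Omega> (J m)"
    "AE x in lebesgue_on \<Omega>. J m x = conductivity P \<sigma> x *\<^sub>R E m x" for m
    using solution[of m] by (simp_all add: conductivity_solution_def)
  interpret two_phase_fields \<Omega> P E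
    using body f_nonzero sol(1) by unfold_locales (simp_all add: f)
  have f_pos: "0 < f \<alpha>" for \<alpha>
    using fraction_pos by (simp add: f)
  \<comment> \<open>\<open>y\<close> is defined with indices \<open>2 1\<close>, whereas the mixed
    energy and \<open>q\<close> use \<open>1 2\<close>.\<close>
  have y': "y \<alpha> = A_mat \<Omega> P E \<alpha> 1 2" for \<alpha>
    by (simp add: y A_mat_commute)
  define p where "p \<alpha> = x \<alpha> - D \<alpha> 1 1 / f \<alpha>" for \<alpha>
  define q where "q \<alpha> = y \<alpha> - D \<alpha> 1 2 / f \<alpha>" for \<alpha>
  define r where "r \<alpha> = z \<alpha> - D \<alpha> 2 2 / f \<alpha>" for \<alpha>
  have form: "0 \<le> p \<alpha> * a\<^sup>2 + 2 * q \<alpha> * a * b + r \<alpha> * b\<^sup>2" for \<alpha> a b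
    using phase_form_nonneg[of \<alpha> 1 a 2 b] by (simp add: p_def q_def r_def x y' z D f)
  have pqr: "0 \<le> p \<alpha>" "0 \<le> r \<alpha>" "(q \<alpha>)\<^sup>2 \<le> p \<alpha> * r \<alpha>" for \<alpha>
    using form by (rule binary_form_nonneg_imp)+
  have x_le: "x \<alpha> \<le> (c \<alpha>)\<^sup>2 * f \<alpha>" and z_le: "z \<alpha> \<le> (c \<alpha>)\<^sup>2 * f \<alpha>" for \<alpha>
    using A_mat_diag_le[OF intact] by (simp_all add: x z f)
  \<comment> \<open>Compatibility bounds the mixed entry only from above, so averaging
    \<open>|F 1 - F 2|^2 \<ge> 0\<close> suffices: \<open>2 y \<le> x + z\<close>, and both diagonal
    entries are already bounded.\<close>
  have y_le: "y \<alpha> \<le> (c \<alpha>)\<^sup>2 * f \<alpha>" for \<alpha>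
  proof -
    let ?F = "phase_field P E \<alpha>"
    have "0 \<le> (LINT x|lebesgue_on \<Omega>. (?F 1 x - ?F 2 x) \<bullet> (?F 1 x - ?F 2 x))"
      by (rule integral_nonneg_AE) simp
    also have "\<dots> = (LINT x|lebesgue_on \<Omega>. ?F 1 x \<bullet> ?F 1 x - 2 * (?F 1 x \<bullet> ?F 2 x) + ?F 2 x \<bullet> ?F 2 x)"
      by (simp add: inner_diff_left inner_diff_right inner_commute algebra_simps)
    also have "\<dots> = measure lebesgue \<Omega> * (x \<alpha> - 2 * y \<alpha> + z \<alpha>)"
      using phase_field_inner_integrable measure_domain_pos
      by (simp add: x y' z A_mat_def average_def field_simps)
    finally have "2 * y \<alpha> \<le> x \<alpha> + z \<alpha>"
      using measure_domain_pos by (simp add: zero_le_mult_iff)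
    with x_le[of \<alpha>] z_le[of \<alpha>] show ?thesis
      by linarith
  qed
  have J_meas: "J m \<in> borel_measurable (lebesgue_on \<Omega>)" for m
    using sol(2) by (simp add: square_integrable_def)
  note split = energy_split[of J, OF sol(3) J_meas]
  have phases:
    "x 2 = (energy \<Omega> E J 1 1 - \<sigma> 1 * x 1) / \<sigma> 2"
    "y 2 = (energy \<Omega> E J 1 2 - \<sigma> 1 * y 1) / \<sigma> 2"
    "z 2 = (energy \<Omega> E J 2 2 - \<sigma> 1 * z 1) / \<sigma> 2"
    using sigma by (simp_all add: split x y' z)
  \<comment> \<open>The phase 2 coordinates computed from \<open>(x 1, y 1, z 1)\<close> are the
    actual averages in phase 2, so membership in either region reduces to inequalities within each
    phase.\<close>
  have coords:
    "phase_coord \<sigma> (energy \<Omega> E J 1 1) (x 1) \<alpha> = x \<alpha>"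
    "phase_coord \<sigma> (energy \<Omega> E J 1 2) (y 1) \<alpha> = y \<alpha>"
    "phase_coord \<sigma> (energy \<Omega> E J 2 2) (z 1) \<alpha> = z \<alpha>" for \<alpha>
    using exhaust_2[of \<alpha>] phases by (auto simp: phase_coord_def)
  have "S_mat \<Omega> P E \<alpha> (x \<alpha>) (y \<alpha>) (z \<alpha>) = vector [vector [p \<alpha>, q \<alpha>], vector [q \<alpha>, r \<alpha>]]" for \<alpha>
    by (simp add: S_mat_def Let_def p_def q_def r_def D f D_mat_commute[of \<alpha> 2 1])
  then have "(x 1, y 1, z 1) \<in> feasible_region \<Omega> P \<sigma> E J"
    using positive_semidefinite_2I[OF form] by (simp add: feasible_region_def coords)
  moreover have "(x 1, y 1, z 1) \<in> compatible_region \<Omega> P \<sigma> c E J"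
    using x_le y_le z_le by (simp add: compatible_region_def coords f)
  moreover have "D \<alpha> 1 1 \<le> (c \<alpha>)\<^sup>2 * (f \<alpha>)\<^sup>2" "D \<alpha> 2 2 \<le> (c \<alpha>)\<^sup>2 * (f \<alpha>)\<^sup>2" for \<alpha>
  proof -
    \<comment> \<open>The diagonal averages \<open>x \<alpha>\<close> and \<open>z \<alpha>\<close>
      lie between the two sides; multiplying by the positive \<open>f \<alpha>\<close> then clears
      the denominator.\<close>
    have "D \<alpha> 1 1 / f \<alpha> \<le> (c \<alpha>)\<^sup>2 * f \<alpha>" "D \<alpha> 2 2 / f \<alpha> \<le> (c \<alpha>)\<^sup>2 * f \<alpha>"
      using pqr(1,2)[of \<alpha>] x_le[of \<alpha>] z_le[of \<alpha>] by (simp_all add: p_def r_def)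
    with f_pos[of \<alpha>] show "D \<alpha> 1 1 \<le> (c \<alpha>)\<^sup>2 * (f \<alpha>)\<^sup>2" "D \<alpha> 2 2 \<le> (c \<alpha>)\<^sup>2 * (f \<alpha>)\<^sup>2"
      by (simp_all add: pos_divide_le_eq power2_eq_square mult.assoc)
  qed
  moreover have "(q \<alpha>)\<^sup>2 \<le> ((c \<alpha>)\<^sup>2 * f \<alpha> - D \<alpha> 1 1 / f \<alpha>) * ((c \<alpha>)\<^sup>2 * f \<alpha> - D \<alpha> 2 2 / f \<alpha>)" for \<alpha>
  proof -
    \<comment> \<open>Replacing \<open>x\<close> and \<open>z\<close> by their upper bound enlarges
      both factors; the product grows because \<open>p\<close> and \<open>r\<close> are
      nonnegative.\<close>
    have "p \<alpha> * r \<alpha> \<le> ((c \<alpha>)\<^sup>2 * f \<alpha> - D \<alpha> 1 1 / f \<alpha>) * ((c \<alpha>)\<^sup>2 * f \<alpha> - D \<alpha> 2 2 / f \<alpha>)"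
      using pqr(1,2)[of \<alpha>] x_le[of \<alpha>] z_le[of \<alpha>]
      by (intro mult_mono) (simp_all add: p_def r_def)
    with pqr(3)[of \<alpha>] show ?thesis
      by linarith
  qed
  ultimately show ?thesis
    using phases pqr unfolding p_def q_def r_def by blast
qed

end
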